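(* Let $\alpha>0$, $n\ge1$, $1\le s\le d$. Assume that $a\ge 2\sigma$ and set $C_1:=2\Phi(2\sqrt c)-1>0$, where $\Phi$ is the standard normal cumulative distribution function. Let $\tau>0$ be such that $$C_1-\tau>0,\qquad \frac{\tau\alpha}{8d}\le1,\qquad \frac{\alpha(C_1-\tau)}{8d}\le 1 .$$ Let $\hat\eta^+$ and $\hat\eta$ be the selectors with components $\hat\eta^+_j=I\bigl(\frac1n\sum_{i=1}^nZ^i_j\ge\tau\bigr)$ and $\hat\eta_j=I\bigl(\bigl|\frac1n\sum_{i=1}^nZ^i_j\bigr|\ge\tau\bigr)$, $j=1,\dots,d$. Then for all $\theta\in\Theta_d^+(s,a)$, with support $S$, $$\mathbb{E}\Bigl[\tfrac1s|\hat\eta^+-\eta|\Bigr]\le\frac{d-|S|}{s}\Bigl[\exp\Bigl(-\frac{n\tau^2}{2^3}\Bigr)+\exp\Bigl(-\frac{\tau^2n\alpha^2}{2^7d^2}\Bigr)\Bigr]+\frac{|S|}{s}\Bigl[\exp\Bigl(-\frac{n(C_1-\tau)^2}{2^3}\Bigr)+\exp\Bigl(-\frac{(C_1-\tau)^2n\alpha^2}{2^7d^2}\Bigr)\Bigr],$$ and for all $\theta\in\Theta_d(s,a)$, with support $S$, $$\mathbb{E}\Bigl[\tfrac1s|\hat\eta-\eta|\Bigr]\le2\,\frac{d-|S|}{s}\Bigl[\exp\Bigl(-\frac{n\tau^2}{2^3}\Bigr)+\exp\Bigl(-\frac{\tau^2n\alpha^2}{2^7d^2}\Bigr)\Bigr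]+2\,\frac{|S|}{s}\Bigl[\exp\Bigl(-\frac{n(C_1-\tau)^2}{2^3}\Bigr)+\exp\Bigl(-\frac{(C_1-\tau)^2n\alpha^2}{2^7d^2}\Bigr)\Bigr].$$
   Context: Model: $\sigma>0$, $\theta\in\mathbb{R}^d$; $X^1,\dots,X^n$ are i.i.d. random vectors in $\mathbb{R}^d$, $X^i=\theta+\sigma\xi^i$, where $\xi^i$ has i.i.d. coordinates whose common law on $\mathbb{R}$ is symmetric around $0$, has variance $1$ and is $c$-strongly log-concave for a constant $c>0$: it has density $p(x)=\exp(-\phi_0(x))\exp(-cx^2/2)$ with $\phi_0:\mathbb{R}\to\mathbb{R}$ a finite even convex function. $\Theta_d^+(s,a)$ (resp. $\Theta_d(s,a)$) is the set of $\theta\in\mathbb{R}^d$ for which there is $S\subseteq\{1,\dots,d\}$ with at most $s$ elements such that $\theta_j\ge a$ (resp. $|\theta_j|\ge a$) for $j\in S$ and $\theta_j=0$ for $j\notin S$. Put $\eta=(I(\theta_j\ne0))_{j=1,\dots,d}$ and $|\hat\eta-\eta|=\sum_{j=1}^d I(\hat\eta_j\neq\eta_j)$. Privatized data (Laplace mechanism): $Z^i_j=\mathrm{sgn}[X^i_j]+\frac{2d}{\alpha}W^i_j$, $i=1,\dots,n$, $j=1,\dots,d$, where $\mathrm{sgn}[x]=1$ for $x\ge0$ and $\mathrm{sgn}[x]=-1$ for $x<0$, and the $W^i_j$ are i.i.d. Laplace$(1)$ variables (density $\frac12e^{-|x|}$), independent of the $X^i$. Expectations are over the joint law of the $X^i$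 and $W^i_j$. *)

theory Defs
  imports "HOL-Probability.Probability"
begin

text \<open>Finiteness of the convex part is automatic, since it is a function into the reals.\<close>

definition even_strongly_log_concave :: "real \<Rightarrow> real measure \<Rightarrow> bool" where
  "even_strongly_log_concave c D \<longleftrightarrow>
     (\<exists>\<phi>0 :: real \<Rightarrow> real.
        convex_on UNIV \<phi>0 \<and> (\<forall>x. \<phi>0 (- x) = \<phi>0 x) \<and>
        D = density lborel (\<lambda>x. ennreal (exp (- \<phi>0 x) * exp (- c * x\<^sup>2 / 2))))"

text \<open>The variance is a Bochner integral, which is \<open>0\<close> for a non-integrable integrand; the
  value \<open>1\<close> therefore entails a finite second moment.\<close>

definition noise_law :: "real \<Rightarrow> real measure \<Rightarrow> bool" where
  "noise_law c D \<longleftrightarrow>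
     prob_space D \<and> distr D borel uminus = D \<and>
     prob_space.variance D (\<lambda>x. x) = 1 \<and>
     even_strongly_log_concave c D"

definition laplace_distribution :: "real measure" where
  "laplace_distribution = density lborel (\<lambda>x. ennreal (exp (- \<bar>x\<bar>) / 2))"

text \<open>The library function \<open>sgn\<close> vanishes at \<open>0\<close>; here the value at \<open>0\<close> is \<open>1\<close>.\<close>

definition sgn1 :: "real \<Rightarrow> real" where
  "sgn1 x = (if 0 \<le> x then 1 else - 1)"

text \<open>The dimension is \<open>CARD('d)\<close>, and coordinates are indexed by the finite type \<open>'d\<close>.\<close>

definition sparse_class_pos :: "nat \<Rightarrow> real \<Rightarrow> (real ^ 'd) set" where
  "sparse_class_pos s a =
     {\<theta>. \<exists>S. card S \<le> s \<and> (\<forall>j\<in>S. a \<le> \<theta> $ j) \<and> (\<forall>j. j \<notin> S \<longrightarrow> \<theta> $ j = 0)}"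

definition sparse_class :: "nat \<Rightarrow> real \<Rightarrow> (real ^ 'd) set" where
  "sparse_class s a =
     {\<theta>. \<exists>S. card S \<le> s \<and> (\<forall>j\<in>S. a \<le> \<bar>\<theta> $ j\<bar>) \<and> (\<forall>j. j \<notin> S \<longrightarrow> \<theta> $ j = 0)}"

definition supp :: "real ^ 'd \<Rightarrow> 'd set" where
  "supp \<theta> = {j. \<theta> $ j \<noteq> 0}"

definition support_vector :: "real ^ 'd \<Rightarrow> nat ^ 'd" where
  "support_vector \<theta> = (\<chi> j. of_bool (\<theta> $ j \<noteq> 0))"

definition hamming :: "nat ^ 'd \<Rightarrow> nat ^ 'd \<Rightarrow> real" where
  "hamming u v = (\<Sum>j\<in>UNIV. of_bool (u $ j \<noteq> v $ j))"

definition observation ::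
  "real \<Rightarrow> real ^ 'd \<Rightarrow> (nat \<Rightarrow> 'w \<Rightarrow> real ^ 'd) \<Rightarrow> nat \<Rightarrow> 'w \<Rightarrow> real ^ 'd" where
  "observation \<sigma> \<theta> \<xi> i \<omega> = \<theta> + \<sigma> *\<^sub>R \<xi> i \<omega>"

definition privatize ::
  "real \<Rightarrow> (nat \<Rightarrow> 'w \<Rightarrow> real ^ 'd) \<Rightarrow> (nat \<Rightarrow> 'w \<Rightarrow> real ^ 'd) \<Rightarrow> nat \<Rightarrow> 'w \<Rightarrow> real ^ 'd" where
  "privatize \<alpha> X W i \<omega> =
     (\<chi> j. sgn1 (X i \<omega> $ j) + 2 * real CARD('d) / \<alpha> * W i \<omega> $ j)"

definition selector_pos ::
  "nat \<Rightarrow> real \<Rightarrow> (nat \<Rightarrow> 'w \<Rightarrow> real ^ 'd) \<Rightarrow> 'w \<Rightarrow> nat ^ 'd" where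
  "selector_pos n \<tau> Z \<omega> = (\<chi> j. of_bool (\<tau> \<le> (\<Sum>i = 1..n. Z i \<omega> $ j) / real n))"

definition selector ::
  "nat \<Rightarrow> real \<Rightarrow> (nat \<Rightarrow> 'w \<Rightarrow> real ^ 'd) \<Rightarrow> 'w \<Rightarrow> nat ^ 'd" where
  "selector n \<tau> Z \<omega> = (\<chi> j. of_bool (\<tau> \<le> \<bar>(\<Sum>i = 1..n. Z i \<omega> $ j) / real n\<bar>))"

text \<open>All coordinates of all the vectors \<open>\<xi> i\<close> and \<open>W i\<close> are jointly independent: the index set is a
  disjoint sum, with \<open>Inl (i, j)\<close> for the coordinate \<open>j\<close> of \<open>\<xi> i\<close> and
  \<open>Inr (i, j)\<close> for the coordinate \<open>j\<close> of \<open>W i\<close>.\<close>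

definition noise_model ::
  "'w measure \<Rightarrow> nat \<Rightarrow> real measure \<Rightarrow>
     (nat \<Rightarrow> 'w \<Rightarrow> real ^ 'd) \<Rightarrow> (nat \<Rightarrow> 'w \<Rightarrow> real ^ 'd) \<Rightarrow> bool" where
  "noise_model M n D \<xi> W \<longleftrightarrow>
     prob_space M \<and>
     prob_space.indep_vars M (\<lambda>_. borel)
       (case_sum (\<lambda>(i, j) \<omega>. \<xi> i \<omega> $ j) (\<lambda>(i, j) \<omega>. W i \<omega> $ j))
       (({1..n} \<times> UNIV) <+> ({1..n} \<times> UNIV)) \<and>
     (\<forall>i\<in>{1..n}. \<forall>j. distr M borel (\<lambda>\<omega>. \<xi> i \<omega> $ j) = D) \<and>
     (\<forall>i\<in>{1..n}. \<forall>j. distr M borel (\<lambda>\<omega>. W i \<omega> $ j) = laplace_distribution)"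

end

theory Submission
  imports Defs
begin

text \<open>
  Writing \<open>Z = sgn X + (2d/\<alpha>) W\<close>, the mean of the \<open>Z\<close>'s in one coordinate deviates by \<open>t\<close> only if the mean
  of the signs or the scaled mean of the Laplace variables deviates by \<open>t/2\<close>. Hoeffding's inequality
  bounds the former; Chernoff's method with \<open>E exp (l W) = 1 / (1 - l\<^sup>2) \<le> exp (2 l\<^sup>2)\<close> for
  \<open>\<bar>l\<bar> \<le> 1/2\<close> bounds the latter, and the two upper bounds on \<open>\<tau>\<close> and \<open>C1 - \<tau>\<close> ensure that the optimal
  \<open>l\<close> lies in this range. The expected sign is \<open>2 F(\<theta>\<^sub>j / \<sigma>) - 1\<close> for the distribution function \<open>F\<close> of
  the noise, which is \<open>0\<close> off the support. On the support its absolute value is at least the noise mass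
  of \<open>[-2, 2]\<close>, which is at least the mass \<open>C1\<close> given to it by the normal law of variance \<open>1/c\<close>:
  the likelihood ratio of the noise to this normal law is a decreasing function of \<open>\<bar>x\<bar>\<close>.
\<close>

section \<open>Likelihood ratios and even convex functions\<close>

text \<open>Write P and G for the laws with densities \<open>p\<close> and \<open>g\<close>.
  Integrating the two hypotheses gives k G(A) <= P(A) and 1 - P(A) <= k (1 - G(A)). Multiplying the
  second by G(A) and the first by 1 - G(A) eliminates k without a division, so \<open>k = 0\<close>
  and G(A) = 0 need no separate case. What remains is G(A) (1 - P(A)) <= P(A) (1 - G(A)).\<close>

lemma measure_density_ge_of_likelihood_ratio:
  fixes p g :: "'a \<Rightarrow> real"
  assumes [measurable]: "p \<in> borel_measurable N" "g \<in> borel_measurable N" "A \<in> sets N"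
    and p: "prob_space (density N (\<lambda>x. ennreal (p x)))"
    and g: "prob_space (density N (\<lambda>x. ennreal (g x)))"
    and k: "0 \<le> k"
    and inside: "\<And>x. x \<in> A \<Longrightarrow> k * g x \<le> p x"
    and outside: "\<And>x. x \<in> space N - A \<Longrightarrow> p x \<le> k * g x"
  shows "measure (density N (\<lambda>x. ennreal (g x))) A \<le> measure (density N (\<lambda>x. ennreal (p x))) A"
proof -
  let ?P = "density N (\<lambda>x. ennreal (p x))" and ?G = "density N (\<lambda>x. ennreal (g x))"
  interpret P: prob_space ?P by (rule p)
  interpret G: prob_space ?G by (rule g)
  have scale: "ennreal (k * measure ?G B) = (\<integral>\<^sup>+x. ennreal (k * g x) * indicator B x \<partial>N)"
    if [measurable]: "B \<in> sets N" for B
    using k by (simp add: ennreal_mult' G.emeasure_eq_measure[symmetric] emeasure_density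
        nn_integral_cmult[symmetric] mult.assoc)
  have int_P: "ennreal (measure ?P B) = (\<integral>\<^sup>+x. ennreal (p x) * indicator B x \<partial>N)"
    if [measurable]: "B \<in> sets N" for B
    by (simp add: P.emeasure_eq_measure[symmetric] emeasure_density)
  have "ennreal (k * measure ?G A) \<le> ennreal (measure ?P A)"
    unfolding scale[OF assms(3)] int_P[OF assms(3)]
    by (intro nn_integral_mono) (auto split: split_indicator intro: ennreal_leI inside)
  then have le_in: "k * measure ?G A \<le> measure ?P A"
    by simp
  have co: "space N - A \<in> sets N"
    by auto
  have "ennreal (measure ?P (space N - A)) \<le> ennreal (k * measure ?G (space N - A))"
    unfolding scale[OF co] int_P[OF co]
    by (intro nn_integral_mono) (auto split: split_indicator intro: ennreal_leI outside)
  then have "measure ?P (space N - A) \<le> k * measure ?G (space N - A)"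
    using k by simp
  then have le_out: "1 - measure ?P A \<le> k * (1 - measure ?G A)"
    using P.prob_compl[of A] G.prob_compl[of A] by simp
  have "measure ?G A * (1 - measure ?P A) \<le> measure ?G A * (k * (1 - measure ?G A))"
    using le_out by (intro mult_left_mono) auto
  also have "\<dots> = (k * measure ?G A) * (1 - measure ?G A)"
    by simp
  also have "\<dots> \<le> measure ?P A * (1 - measure ?G A)"
    using le_in by (intro mult_right_mono) auto
  finally show ?thesis
    by (simp add: algebra_simps)
qed

text \<open>The point \<open>x\<close> is a convex combination of \<open>- y\<close> and
  \<open>y\<close>, where \<open>f\<close> takes the same value. The weight \<open>u\<close> of
  \<open>y\<close> is found by solving for it, which requires \<open>y\<close> to be nonzero; for
  \<open>y = 0\<close> also \<open>x = 0\<close>.\<close>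

lemma even_convex_mono_abs:
  fixes f :: "real \<Rightarrow> real"
  assumes convex: "convex_on UNIV f" and even: "\<And>x. f (- x) = f x" and le: "\<bar>x\<bar> \<le> \<bar>y\<bar>"
  shows "f x \<le> f y"
proof (cases "y = 0")
  case False
  define u where "u = (1 + x / y) / 2"
  have "\<bar>x / y\<bar> \<le> 1"
    unfolding abs_divide using le False by simp
  then have u: "0 \<le> u" "u \<le> 1"
    unfolding u_def abs_le_iff by auto
  have "x = u * y + (1 - u) * (- y)"
    using False by (simp add: u_def field_simps)
  then have "f x \<le> u * f y + (1 - u) * f (- y)"
    using convex_onD[OF convex, of u "- y" y] u by (simp add: add.commute)
  then show ?thesis
    by (simp add: even algebra_simps)
qed (use le in auto)

section \<open>Symmetric laws and the normal law\<close>

lemma measure_uminus_symmetric: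
  fixes G :: "real measure"
  assumes "sets G = sets borel" "distr G borel uminus = G" "A \<in> sets borel"
  shows "measure G (uminus ` A) = measure G A"
proof -
  have [measurable]: "uminus \<in> measurable G borel"
    unfolding measurable_cong_sets[OF assms(1) refl] by measurable
  have "measure G A = measure (distr G borel uminus) A"
    by (simp add: assms(2))
  also have "\<dots> = measure G (uminus -` A \<inter> space G)"
    using assms(3) by (intro measure_distr \<open>uminus \<in> measurable G borel\<close>)
  also have "uminus -` A \<inter> space G = uminus ` A"
    using sets_eq_imp_space_eq[OF assms(1)] by (auto intro: image_eqI[of _ uminus "- x" for x])
  finally show ?thesis by simp
qed

text \<open>By symmetry \<open>{..<- y}\<close> has the mass \<open>1 - cdf G y\<close> of
  \<open>{y<..}\<close>, and \<open>cdf G y\<close> is this mass plus that of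
  \<open>{- y..y}\<close>. Open tails around a closed interval keep the identity exact even if
  \<open>G\<close> has atoms.\<close>

lemma cdf_eq_measure_Icc_symmetric:
  fixes G :: "real measure"
  assumes "prob_space G" and [simp]: "sets G = sets borel" and symm: "distr G borel uminus = G"
    and "0 \<le> y"
  shows "2 * cdf G y - 1 = measure G {- y..y}"
proof -
  interpret prob_space G by fact
  have sp: "space G = UNIV"
    using sets_eq_imp_space_eq[of G borel] by simp
  have compl: "measure G {y<..} = 1 - cdf G y"
    using prob_compl[of "{..y}"] by (simp add: sp cdf_def Compl_eq_Diff_UNIV[symmetric] Compl_atMost)
  have "measure G {..<- y} = measure G {y<..}"
    using measure_uminus_symmetric[OF _ symm, of "{y<..}"] by simp
  moreover have "{..y} = {..<- y} \<union> {- y..y}"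
    using \<open>0 \<le> y\<close> by auto
  then have "cdf G y = measure G {..<- y} + measure G {- y..y}"
    unfolding cdf_def by (simp only:) (intro finite_measure_Union, auto)
  ultimately show ?thesis
    using compl by simp
qed

lemma distr_uminus_density_even:
  fixes f :: "real \<Rightarrow> real"
  assumes [measurable]: "f \<in> borel_measurable borel" and even: "\<And>x. f (- x) = f x"
  shows "distr (density lborel f) borel uminus = density lborel f"
proof -
  have "density lborel f = density (distr lborel borel uminus) f"
    by (simp add: lborel_distr_uminus)
  also have "\<dots> = distr (density lborel (\<lambda>x. ennreal (f (- x)))) borel uminus"
    by (intro density_distr) auto
  finally show ?thesis
    by (simp add: even)
qed

text \<open>The second argument of \<open>normal_density\<close> is the standard deviation, so the
  law has variance \<open>1 / c\<close>, and multiplication by \<open>sqrt c\<close> standardizes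
  it. With \<open>y = 2\<close> this is the origin of \<open>2 * sqrt c\<close> in
  \<open>C1\<close>.\<close>

lemma normal_measure_Icc_scale:
  assumes "0 < c"
  shows "measure (density lborel (normal_density 0 (1 / sqrt c))) {- y..y} =
    measure std_normal_distribution {- (y * sqrt c)..y * sqrt c}"
proof -
  let ?G = "density lborel (\<lambda>x. ennreal (normal_density 0 (1 / sqrt c) x))"
  interpret prob_space ?G
    using assms by (intro prob_space_normal_density) simp
  have "distributed ?G lborel (\<lambda>x. x) (\<lambda>x. ennreal (normal_density 0 (1 / sqrt c) x))"
    by (auto simp: distributed_def distr_id2)
  then have "distributed ?G lborel (\<lambda>x. x * sqrt c) std_normal_density"
    using assms by (subst (asm) normal_standard_normal_convert) auto
  then have "std_normal_distribution = distr ?G lborel (\<lambda>x. x * sqrt c)"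
    by (simp add: distributed_distr_eq_density)
  then have "measure std_normal_distribution {- (y * sqrt c)..y * sqrt c} =
      measure ?G ((\<lambda>x. x * sqrt c) -` {- (y * sqrt c)..y * sqrt c} \<inter> space ?G)"
    by (simp add: measure_distr)
  also have "(\<lambda>x. x * sqrt c) -` {- (y * sqrt c)..y * sqrt c} \<inter> space ?G = {- y..y}"
    using mult_le_cancel_right_pos[of "sqrt c" "- y"] mult_le_cancel_right_pos[of "sqrt c" _ y] assms
    by auto
  finally show ?thesis by simp
qed

lemma two_cdf_std_normal_eq:
  assumes "0 \<le> y"
  shows "2 * cdf std_normal_distribution y - 1 = measure std_normal_distribution {- y..y}"
  using assms by (intro cdf_eq_measure_Icc_symmetric prob_space_normal_density distr_uminus_density_even)
    (auto simp: normal_density_def)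

text \<open>On an interval of length \<open>2 * y\<close> the density is at least its value at the
  ends. This yields \<open>C1 > 0\<close>.\<close>

lemma std_normal_measure_Icc_pos:
  assumes "0 < y"
  shows "0 < measure std_normal_distribution {- y..y}"
proof -
  interpret prob_space std_normal_distribution
    by (rule prob_space_normal_density) simp
  have "ennreal (std_normal_density y * (2 * y)) =
      (\<integral>\<^sup>+x. ennreal (std_normal_density y) * indicator {- y..y} x \<partial>lborel)"
    using assms by (simp add: nn_integral_cmult ennreal_mult')
  also have "\<dots> \<le> (\<integral>\<^sup>+x. ennreal (std_normal_density x) * indicator {- y..y} x \<partial>lborel)"
    by (intro nn_integral_mono)
      (auto simp: std_normal_density_def abs_le_square_iff[symmetric] abs_le_iff split: split_indicator
        intro!: ennreal_leI divide_right_mono)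
  also have "\<dots> = ennreal (measure std_normal_distribution {- y..y})"
    by (simp add: emeasure_density emeasure_eq_measure[symmetric])
  finally have "std_normal_density y * (2 * y) \<le> measure std_normal_distribution {- y..y}"
    by simp
  moreover have "0 < std_normal_density y * (2 * y)"
    using assms by (simp add: normal_density_pos)
  ultimately show ?thesis by linarith
qed

section \<open>Distribution function of the noise\<close>

lemma cdf_strongly_log_concave_ge:
  assumes "0 < c" and D: "noise_law c D" and "0 \<le> y"
  shows "2 * cdf std_normal_distribution (y * sqrt c) - 1 \<le> 2 * cdf D y - 1"
proof -
  from D obtain \<phi> :: "real \<Rightarrow> real" where convex: "convex_on UNIV \<phi>"
    and even: "\<And>x. \<phi> (- x) = \<phi> x"
    and D_eq: "D = density lborel (\<lambda>x. ennreal (exp (- \<phi> x) * exp (- c * x\<^sup>2 / 2)))"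
    and ps: "prob_space D" and symm: "distr D borel uminus = D"
    unfolding noise_law_def even_strongly_log_concave_def by auto
  have [measurable]: "\<phi> \<in> borel_measurable borel"
    using convex_on_continuous[OF open_UNIV convex] by (rule borel_measurable_continuous_onI)
  \<comment> \<open>\<open>K\<close> normalizes the Gaussian factor, so the likelihood ratio at
    \<open>x\<close> is \<open>exp (- \<phi> x) * K\<close>. It does not increase with
    \<open>\<bar>x\<bar>\<close>, hence its value at \<open>y\<close> separates
    \<open>{- y..y}\<close> from the complement and serves as \<open>k\<close> below.\<close>
  define K where "K = sqrt (2 * pi / c)"
  have K: "0 < K"
    using \<open>0 < c\<close> by (simp add: K_def)
  have g: "normal_density 0 (1 / sqrt c) x = exp (- c * x\<^sup>2 / 2) / K" for x
    using \<open>0 < c\<close> by (simp add: normal_density_def K_def power_divide)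
  have "measure (density lborel (normal_density 0 (1 / sqrt c))) {- y..y} \<le> measure D {- y..y}"
    unfolding D_eq
  proof (rule measure_density_ge_of_likelihood_ratio[where k = "exp (- \<phi> y) * K"])
    show "prob_space (density lborel (\<lambda>x. ennreal (exp (- \<phi> x) * exp (- c * x\<^sup>2 / 2))))"
      using ps D_eq by simp
    show "prob_space (density lborel (\<lambda>x. ennreal (normal_density 0 (1 / sqrt c) x)))"
      using \<open>0 < c\<close> by (intro prob_space_normal_density) simp
    show "exp (- \<phi> y) * K * normal_density 0 (1 / sqrt c) x \<le> exp (- \<phi> x) * exp (- c * x\<^sup>2 / 2)"
      if "x \<in> {- y..y}" for x
      using even_convex_mono_abs[OF convex even, of x y] that K by (simp add: g abs_le_iff)
    show "exp (- \<phi> x) * exp (- c * x\<^sup>2 / 2) \<le> exp (- \<phi> y) * K * normal_density 0 (1 / sqrt c) x"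
      if "x \<in> space lborel - {- y..y}" for x
      using even_convex_mono_abs[OF convex even, of y x] that K \<open>0 \<le> y\<close> by (force simp: g)
  qed (use K in auto)
  also have "\<dots> = 2 * cdf D y - 1"
    using cdf_eq_measure_Icc_symmetric[OF ps _ symm \<open>0 \<le> y\<close>] by (simp add: D_eq)
  finally show ?thesis
    using \<open>0 < c\<close> \<open>0 \<le> y\<close> by (simp add: normal_measure_Icc_scale two_cdf_std_normal_eq)
qed

text \<open>Reflection turns \<open>cdf D (- y)\<close> into the mass of \<open>{y..}\<close>, whose
  complement is \<open>{..<y}\<close>. Passing to \<open>{..y}\<close> needs that \<open>D\<close>
  has no atoms, which its Lebesgue density provides. The case \<open>y = 0\<close> gives the signs
  mean \<open>0\<close> off the support.\<close>

lemma cdf_noise_law_minus: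
  assumes "noise_law c D"
  shows "cdf D (- y) = 1 - cdf D y"
proof -
  from assms obtain \<phi> :: "real \<Rightarrow> real" where convex: "convex_on UNIV \<phi>"
    and D_eq: "D = density lborel (\<lambda>x. ennreal (exp (- \<phi> x) * exp (- c * x\<^sup>2 / 2)))"
    and ps: "prob_space D" and symm: "distr D borel uminus = D"
    unfolding noise_law_def even_strongly_log_concave_def by auto
  interpret prob_space D by (rule ps)
  have [measurable]: "\<phi> \<in> borel_measurable borel"
    using convex_on_continuous[OF open_UNIV convex] by (rule borel_measurable_continuous_onI)
  have [simp]: "sets D = sets borel" "space D = UNIV"
    by (simp_all add: D_eq)
  have "emeasure D {y} = 0"
    by (simp add: D_eq emeasure_density nn_integral_0_iff_AE AE_lborel_singleton
        eventually_mono[OF AE_lborel_singleton[of y]])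
  then have atom: "measure D {y} = 0"
    by (simp add: measure_def)
  have "cdf D y = measure D ({..<y} \<union> {y})"
    unfolding cdf_def by (intro arg_cong[where f = "measure D"]) auto
  also have "\<dots> = measure D {..<y}"
    using atom by (subst finite_measure_Union) auto
  also have "\<dots> = 1 - measure D {y..}"
    using prob_compl[of "{y..}"] by (simp add: Compl_eq_Diff_UNIV[symmetric] Compl_atLeast)
  also have "measure D {y..} = cdf D (- y)"
    using measure_uminus_symmetric[OF _ symm, of "{y..}"] by (simp add: cdf_def)
  finally show ?thesis by simp
qed

section \<open>Exponential moments and tails of Laplace variables\<close>

text \<open>Splitting at \<open>0\<close> leaves exponential integrals with rates
  \<open>1 - t\<close> and \<open>1 + t\<close>, both positive. Both half-lines contain
  \<open>0\<close>, so the split is only a pointwise inequality; an upper bound is all that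
  Chernoff's method needs.\<close>

lemma Laplace_exponential_moment:
  assumes t: "\<bar>t\<bar> < 1"
  shows "(\<integral>\<^sup>+x. ennreal (exp (t * x)) \<partial>laplace_distribution) \<le> ennreal (1 / (1 - t\<^sup>2))"
proof -
  have half: "(\<integral>\<^sup>+x. ennreal (exp (- (l * x)) / 2) * indicator {0..} x \<partial>lborel) = ennreal (1 / (2 * l))"
    if "0 < l" for l :: real
  proof -
    interpret E: prob_space "density lborel (\<lambda>x. ennreal (exponential_density l x))"
      using that by (rule prob_space_exponential_density)
    have "(\<integral>\<^sup>+x. ennreal (exp (- (l * x)) / 2) * indicator {0..} x \<partial>lborel) =
        (\<integral>\<^sup>+x. ennreal (1 / (2 * l)) * ennreal (exponential_density l x) \<partial>lborel)"
      using that by (intro nn_integral_cong)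
        (auto simp: exponential_density_def ennreal_mult'[symmetric] mult.commute split: split_indicator)
    also have "\<dots> = ennreal (1 / (2 * l)) * (\<integral>\<^sup>+x. ennreal (exponential_density l x) \<partial>lborel)"
      by (intro nn_integral_cmult) auto
    also have "(\<integral>\<^sup>+x. ennreal (exponential_density l x) \<partial>lborel) = 1"
      using E.emeasure_space_1 by (simp add: emeasure_density)
    finally show ?thesis by simp
  qed
  have "(\<integral>\<^sup>+x. ennreal (exp (t * x)) \<partial>laplace_distribution) =
      (\<integral>\<^sup>+x. ennreal (exp (- \<bar>x\<bar>) / 2) * ennreal (exp (t * x)) \<partial>lborel)"
    unfolding laplace_distribution_def by (intro nn_integral_density) auto
  also have "\<dots> \<le> (\<integral>\<^sup>+x. ennreal (exp (- ((1 - t) * x)) / 2) * indicator {0..} x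
      + ennreal (exp ((1 + t) * x) / 2) * indicator {..0} x \<partial>lborel)"
    by (intro nn_integral_mono)
      (auto split: split_indicator simp: ennreal_mult'[symmetric] exp_add[symmetric] algebra_simps
        simp flip: ennreal_plus)
  also have "\<dots> = ennreal (1 / (2 * (1 - t))) +
      (\<integral>\<^sup>+x. ennreal (exp ((1 + t) * x) / 2) * indicator {..0} x \<partial>lborel)"
    using t by (subst nn_integral_add) (auto simp: half)
  also have "(\<integral>\<^sup>+x. ennreal (exp ((1 + t) * x) / 2) * indicator {..0} x \<partial>lborel) =
      (\<integral>\<^sup>+x. ennreal (exp (- ((1 + t) * x)) / 2) * indicator {0..} x \<partial>lborel)"
    by (subst nn_integral_real_affine[where c = "-1" and t = 0])
      (auto intro!: nn_integral_cong split: split_indicator)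
  also have "\<dots> = ennreal (1 / (2 * (1 + t)))"
    using t by (intro half) auto
  also have "ennreal (1 / (2 * (1 - t))) + ennreal (1 / (2 * (1 + t))) =
      ennreal (1 / (2 * (1 - t)) + 1 / (2 * (1 + t)))"
    using t by (intro ennreal_plus[symmetric]) (auto simp: abs_less_iff)
  also have "1 / (2 * (1 - t)) + 1 / (2 * (1 + t)) = 1 / (1 - t\<^sup>2)"
  proof -
    have *: "1 - t\<^sup>2 = (1 - t) * (1 + t)"
      by (simp add: power2_eq_square algebra_simps)
    show ?thesis
      unfolding * using t by (auto simp: divide_simps abs_less_iff) (simp add: algebra_simps)
  qed
  finally show ?thesis .
qed

text \<open>Since 1 + 2 t^2 <= exp (2 t^2), it suffices that (1 + 2 t^2) (1 - t^2) = 1 + t^2 - 2 t^4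
  is at least 1, and t^2 <= 1/4 gives 2 t^4 <= t^2.\<close>

lemma Laplace_sub_gaussian:
  assumes t: "\<bar>t\<bar> \<le> 1 / 2"
  shows "(\<integral>\<^sup>+x. ennreal (exp (t * x)) \<partial>laplace_distribution) \<le> ennreal (exp (2 * t\<^sup>2))"
proof -
  have u: "t\<^sup>2 \<le> 1 / 4"
    using power_mono[OF t, of 2] by (simp add: power_divide)
  have "2 * t\<^sup>2 * t\<^sup>2 \<le> 1 * t\<^sup>2"
    using u by (intro mult_right_mono) auto
  then have "1 \<le> (1 + 2 * t\<^sup>2) * (1 - t\<^sup>2)"
    by (simp add: ring_distribs)
  also have "\<dots> \<le> exp (2 * t\<^sup>2) * (1 - t\<^sup>2)"
    using u by (intro mult_right_mono exp_ge_add_one_self) auto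
  finally have "1 / (1 - t\<^sup>2) \<le> exp (2 * t\<^sup>2)"
    using u by (simp add: field_simps)
  then show ?thesis
    using t by (intro order_trans[OF Laplace_exponential_moment] ennreal_leI) auto
qed

text \<open>The model states independence over a disjoint sum of index pairs. Pulling it back along
  an injection makes a fixed coordinate an independent family indexed by the sample number
  alone.\<close>

lemma (in prob_space) indep_vars_reindex:
  assumes inj: "inj_on f I" and indep: "indep_vars N X (f ` I)"
  shows "indep_vars (\<lambda>i. N (f i)) (\<lambda>i. X (f i)) I"
proof -
  define F where "F i = {X i -` A \<inter> space M | A. A \<in> sets (N i)}" for i
  from indep have rv: "\<And>i. i \<in> f ` I \<Longrightarrow> random_variable (N i) (X i)" and F: "indep_sets F (f ` I)"
    unfolding indep_vars_def2 F_def by auto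
  have "indep_sets (\<lambda>i. F (f i)) I"
  proof (rule indep_setsI)
    show "F (f i) \<subseteq> events" if "i \<in> I" for i
      using F that unfolding indep_sets_def by auto
    fix A J assume J: "J \<noteq> {}" "J \<subseteq> I" "finite J" and A: "\<forall>j\<in>J. A j \<in> F (f j)"
    have inj_J: "inj_on f J"
      using inj J(2) by (rule inj_on_subset)
    \<comment> \<open>The events are re-indexed over the image of \<open>J\<close>; injectivity
      makes the inverse well defined there and keeps distinct factors distinct.\<close>
    define A' where "A' i = A (inv_into J f i)" for i
    have A': "A' (f j) = A j" if "j \<in> J" for j
      using inj_J that by (simp add: A'_def)
    have "prob (\<Inter>j\<in>f ` J. A' j) = (\<Prod>j\<in>f ` J. prob (A' j))"
      using J A A' by (intro indep_setsD[OF F]) auto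
    then show "prob (\<Inter>j\<in>J. A j) = (\<Prod>j\<in>J. prob (A j))"
      using inj_J A' by (simp add: prod.reindex)
  qed
  then show ?thesis
    unfolding indep_vars_def2 using rv by (auto simp: F_def)
qed

lemma (in prob_space) Laplace_sum_tail:
  fixes W :: "'i \<Rightarrow> 'a \<Rightarrow> real"
  assumes I: "finite I" and indep: "indep_vars (\<lambda>_. borel) W I"
    and law: "\<And>i. i \<in> I \<Longrightarrow> distr M borel (W i) = laplace_distribution"
    and x: "0 < x" "x \<le> 2"
  shows "prob {\<omega>\<in>space M. real (card I) * x \<le> (\<Sum>i\<in>I. W i \<omega>)} \<le> exp (- (real (card I) * x\<^sup>2 / 8))"
proof -
  \<comment> \<open>With N = \<open>card I\<close>, the Chernoff bound is exp (N (2 l^2 - l x)),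
    smallest at l = x/4, where it is exp (- N x^2 / 8). The hypothesis \<open>x \<le> 2\<close>
    keeps \<open>l\<close> in the range of \<open>Laplace_sub_gaussian\<close>.\<close>
  define l where "l = x / 4"
  have l: "0 < l" "\<bar>l\<bar> \<le> 1 / 2"
    using x by (auto simp: l_def)
  have [measurable]: "random_variable borel (W i)" if "i \<in> I" for i
    using indep that by (auto simp: indep_vars_def)
  have "ennreal (prob {\<omega>\<in>space M. real (card I) * x \<le> (\<Sum>i\<in>I. W i \<omega>)}) =
      emeasure M {\<omega>\<in>space M. real (card I) * x \<le> (\<Sum>i\<in>I. W i \<omega>)}"
    by (simp add: emeasure_eq_measure)
  also have "\<dots> \<le> ennreal (exp (- l * (real (card I) * x))) *
      (\<integral>\<^sup>+\<omega>\<in>space M. exp (l * (\<Sum>i\<in>I. W i \<omega>)) \<partial>M)"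
    using l by (intro Chernoff_ineq_nn_integral_ge) auto
  also have "(\<integral>\<^sup>+\<omega>\<in>space M. exp (l * (\<Sum>i\<in>I. W i \<omega>)) \<partial>M) = (\<integral>\<^sup>+\<omega>. (\<Prod>i\<in>I. ennreal (exp (l * W i \<omega>))) \<partial>M)"
    using I by (intro nn_integral_cong) (simp add: sum_distrib_left exp_sum prod_ennreal)
  also have "\<dots> = (\<Prod>i\<in>I. \<integral>\<^sup>+\<omega>. ennreal (exp (l * W i \<omega>)) \<partial>M)"
    by (intro indep_vars_nn_integral I indep_vars_compose2[OF indep]) auto
  also have "\<dots> = (\<Prod>i\<in>I. \<integral>\<^sup>+w. ennreal (exp (l * w)) \<partial>laplace_distribution)"
    by (intro prod.cong refl) (simp add: law[symmetric] nn_integral_distr)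
  also have "\<dots> \<le> (\<Prod>i\<in>I. ennreal (exp (2 * l\<^sup>2)))"
    by (intro prod_mono_ennreal Laplace_sub_gaussian l)
  also have "ennreal (exp (- l * (real (card I) * x))) * \<dots> =
      ennreal (exp (- l * (real (card I) * x) + real (card I) * (2 * l\<^sup>2)))"
    by (simp add: ennreal_power ennreal_mult'[symmetric] exp_add exp_of_nat_mult exp_diff
        exp_minus divide_inverse mult.commute)
  also have "- l * (real (card I) * x) + real (card I) * (2 * l\<^sup>2) = - (real (card I) * x\<^sup>2 / 8)"
    by (simp add: l_def power2_eq_square field_simps)
  finally show ?thesis
    by (simp add: mult_left_mono)
qed

lemma laplace_distribution_symmetric: "distr laplace_distribution borel uminus = laplace_distribution"
  unfolding laplace_distribution_def by (intro distr_uminus_density_even) auto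

section \<open>Tails of the privatized mean\<close>

lemma (in prob_space) noisy_mean_upper_tail:
  fixes V W :: "nat \<Rightarrow> 'a \<Rightarrow> real"
  assumes n: "1 \<le> n"
    and indep_V: "indep_vars (\<lambda>_. borel) V {1..n}"
    and indep_W: "indep_vars (\<lambda>_. borel) W {1..n}"
    and bounded: "\<And>i \<omega>. V i \<omega> \<in> {-1..1}"
    and law: "\<And>i. i \<in> {1..n} \<Longrightarrow> distr M borel (W i) = laplace_distribution"
    and mean: "\<And>i. i \<in> {1..n} \<Longrightarrow> expectation (V i) \<le> m"
    and k: "0 < k" and t: "0 < t" "t \<le> 4 * k"
  shows "prob {\<omega>\<in>space M. m + t \<le> (\<Sum>i = 1..n. V i \<omega> + k * W i \<omega>) / real n}
    \<le> exp (- (real n * t\<^sup>2 / 8)) + exp (- (real n * (t / k)\<^sup>2 / 32))"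
proof -
  interpret Hoeffding_ineq M "{1..n}" V "\<lambda>_. -1" "\<lambda>_. 1" "\<Sum>i = 1..n. expectation (V i)"
    using indep_V bounded by unfold_locales auto
  have [measurable]: "random_variable borel (V i)" "random_variable borel (W i)" if "i \<in> {1..n}" for i
    using indep_V indep_W that by (auto simp: indep_vars_def)
  let ?\<mu> = "\<Sum>i = 1..n. expectation (V i)"
  \<comment> \<open>Each source of randomness receives half of the total deviation
    \<open>real n * t\<close>; \<open>?B\<close> is the event that \<open>k\<close> times the
    Laplace sum reaches its half.\<close>
  let ?A = "{\<omega>\<in>space M. ?\<mu> + real n * t / 2 \<le> (\<Sum>i = 1..n. V i \<omega>)}"
  let ?B = "{\<omega>\<in>space M. real (card {1..n}) * (t / (2 * k)) \<le> (\<Sum>i = 1..n. W i \<omega>)}"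
  have \<mu>: "?\<mu> \<le> real n * m"
    using sum_mono[OF mean, of "{1..n}" "\<lambda>i. i"] by simp
  have "{\<omega>\<in>space M. m + t \<le> (\<Sum>i = 1..n. V i \<omega> + k * W i \<omega>) / real n} \<subseteq> ?A \<union> ?B"
  proof safe
    fix \<omega> assume "m + t \<le> (\<Sum>i = 1..n. V i \<omega> + k * W i \<omega>) / real n"
      and notB: "\<not> real (card {1..n}) * (t / (2 * k)) \<le> (\<Sum>i = 1..n. W i \<omega>)"
    then have "real n * m + real n * t \<le> (\<Sum>i = 1..n. V i \<omega>) + k * (\<Sum>i = 1..n. W i \<omega>)"
      using n by (simp add: field_simps sum.distrib sum_distrib_left)
    moreover have "k * (\<Sum>i = 1..n. W i \<omega>) < real n * t / 2"
      using notB k by (simp add: field_simps)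
    ultimately show "?\<mu> + real n * t / 2 \<le> (\<Sum>i = 1..n. V i \<omega>)"
      using \<mu> by linarith
  qed
  then have "prob {\<omega>\<in>space M. m + t \<le> (\<Sum>i = 1..n. V i \<omega> + k * W i \<omega>) / real n} \<le> prob (?A \<union> ?B)"
    by (intro finite_measure_mono) auto
  also have "\<dots> \<le> prob ?A + prob ?B"
    by (intro measure_Un_le) auto
  \<comment> \<open>Each \<open>V i\<close> has range of length 2, so Hoeffding's denominator is
    \<open>4 * n\<close>.\<close>
  also have "prob ?A \<le> exp (- 2 * (real n * t / 2)\<^sup>2 / (\<Sum>i = 1..n. (1 - - 1)\<^sup>2))"
    using n t by (intro Hoeffding_ineq_ge) auto
  also have "- 2 * (real n * t / 2)\<^sup>2 / (\<Sum>i = 1..n. (1 - - 1)\<^sup>2) = - (real n * t\<^sup>2 / 8)"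
    using n by (simp add: power2_eq_square field_simps)
  \<comment> \<open>The condition \<open>t / (2 * k) \<le> 2\<close> of
    \<open>Laplace_sum_tail\<close> is exactly \<open>t \<le> 4 * k\<close>.\<close>
  also have "prob ?B \<le> exp (- (real (card {1..n}) * (t / (2 * k))\<^sup>2 / 8))"
    using k t by (intro Laplace_sum_tail indep_W law) (auto simp: field_simps)
  also have "- (real (card {1..n}) * (t / (2 * k))\<^sup>2 / 8) = - (real n * (t / k)\<^sup>2 / 32)"
    using k by (simp add: power2_eq_square field_simps)
  finally show ?thesis by simp
qed

text \<open>Negating both families reduces this to the upper tail, because the Laplace law and
  \<open>{-1..1}\<close> are symmetric.\<close>

lemma (in prob_space) noisy_mean_lower_tail:
  fixes V W :: "nat \<Rightarrow> 'a \<Rightarrow> real"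
  assumes n: "1 \<le> n"
    and indep_V: "indep_vars (\<lambda>_. borel) V {1..n}"
    and indep_W: "indep_vars (\<lambda>_. borel) W {1..n}"
    and bounded: "\<And>i \<omega>. V i \<omega> \<in> {-1..1}"
    and law: "\<And>i. i \<in> {1..n} \<Longrightarrow> distr M borel (W i) = laplace_distribution"
    and mean: "\<And>i. i \<in> {1..n} \<Longrightarrow> m \<le> expectation (V i)"
    and k: "0 < k" and t: "0 < t" "t \<le> 4 * k"
  shows "prob {\<omega>\<in>space M. (\<Sum>i = 1..n. V i \<omega> + k * W i \<omega>) / real n \<le> m - t}
    \<le> exp (- (real n * t\<^sup>2 / 8)) + exp (- (real n * (t / k)\<^sup>2 / 32))"
proof -
  have [measurable]: "random_variable borel (W i)" if "i \<in> {1..n}" for i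
    using indep_W that by (auto simp: indep_vars_def)
  have neg_law: "distr M borel (\<lambda>\<omega>. - W i \<omega>) = laplace_distribution" if "i \<in> {1..n}" for i
  proof -
    have "distr M borel (\<lambda>\<omega>. - W i \<omega>) = distr (distr M borel (W i)) borel uminus"
      using that by (subst distr_distr) (auto simp: comp_def)
    then show ?thesis
      using that by (simp only: law laplace_distribution_symmetric)
  qed
  have "(\<Sum>i = 1..n. V i \<omega> + k * W i \<omega>) / real n \<le> m - t \<longleftrightarrow>
      - m + t \<le> (\<Sum>i = 1..n. - V i \<omega> + k * - W i \<omega>) / real n" for \<omega>
  proof -
    have "(\<Sum>i = 1..n. - V i \<omega> + k * - W i \<omega>) = - (\<Sum>i = 1..n. V i \<omega> + k * W i \<omega>)"
      unfolding sum_negf[symmetric] by (intro sum.cong) auto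
    then show ?thesis by auto
  qed
  moreover have "prob {\<omega>\<in>space M. - m + t \<le> (\<Sum>i = 1..n. - V i \<omega> + k * - W i \<omega>) / real n}
    \<le> exp (- (real n * t\<^sup>2 / 8)) + exp (- (real n * (t / k)\<^sup>2 / 32))"
  proof (rule noisy_mean_upper_tail)
    show "indep_vars (\<lambda>_. borel) (\<lambda>i \<omega>. - V i \<omega>) {1..n}" "indep_vars (\<lambda>_. borel) (\<lambda>i \<omega>. - W i \<omega>) {1..n}"
      by (rule indep_vars_compose2[OF indep_V] indep_vars_compose2[OF indep_W]; simp)+
    show "expectation (\<lambda>\<omega>. - V i \<omega>) \<le> - m" if "i \<in> {1..n}" for i
      using mean[OF that] by simp
    show "- V i \<omega> \<in> {- 1..1}" for i \<omega>
      using bounded[of i \<omega>] by auto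
  qed (use assms neg_law in auto)
  ultimately show ?thesis by simp
qed

section \<open>Expected signs and expected Hamming loss\<close>

lemma borel_measurable_sgn1 [measurable]: "sgn1 \<in> borel_measurable borel"
  unfolding sgn1_def by measurable

text \<open>As \<open>sgn1\<close> is \<open>1\<close> at \<open>0\<close>, the sign is positive on
  the closed half-line \<open>{- (b / \<sigma>)..}\<close> of values of \<open>X\<close>. Its
  reflection is \<open>{..b / \<sigma>}\<close>, whose mass is the \<open>cdf\<close> value even if
  the law has atoms.\<close>

lemma (in prob_space) expectation_sgn1_shift:
  assumes [measurable]: "random_variable borel X" and \<sigma>: "0 < \<sigma>"
    and symm: "distr (distr M borel X) borel uminus = distr M borel X"
  shows "expectation (\<lambda>\<omega>. sgn1 (b + \<sigma> * X \<omega>)) = 2 * cdf (distr M borel X) (b / \<sigma>) - 1"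
proof -
  let ?A = "{\<omega>\<in>space M. 0 \<le> b + \<sigma> * X \<omega>}"
  have A: "?A = X -` {- (b / \<sigma>)..} \<inter> space M"
    using \<sigma> by (auto simp: field_simps)
  have "expectation (\<lambda>\<omega>. sgn1 (b + \<sigma> * X \<omega>)) = expectation (\<lambda>\<omega>. 2 * indicator ?A \<omega> - 1)"
    by (intro Bochner_Integration.integral_cong) (auto simp: sgn1_def)
  also have "\<dots> = 2 * prob ?A - 1"
    by (subst Bochner_Integration.integral_diff) (auto simp: prob_space emeasure_eq_measure)
  also have "prob ?A = measure (distr M borel X) {- (b / \<sigma>)..}"
    unfolding A by (simp add: measure_distr)
  also have "\<dots> = cdf (distr M borel X) (b / \<sigma>)"
    using measure_uminus_symmetric[OF _ symm, of "{..b / \<sigma>}"] by (simp add: cdf_def)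
  finally show ?thesis .
qed

text \<open>By linearity the expected loss is the sum of the error probabilities of the coordinates,
  whatever their dependence.\<close>

lemma (in prob_space) expectation_hamming_le:
  fixes \<eta> :: "'a \<Rightarrow> nat ^ 'd" and \<theta> :: "real ^ 'd"
  assumes [measurable]: "\<And>j. {\<omega>\<in>space M. \<eta> \<omega> $ j \<noteq> support_vector \<theta> $ j} \<in> events"
    and off: "\<And>j. j \<notin> supp \<theta> \<Longrightarrow> prob {\<omega>\<in>space M. \<eta> \<omega> $ j \<noteq> support_vector \<theta> $ j} \<le> b0"
    and on: "\<And>j. j \<in> supp \<theta> \<Longrightarrow> prob {\<omega>\<in>space M. \<eta> \<omega> $ j \<noteq> support_vector \<theta> $ j} \<le> b1"
  shows "expectation (\<lambda>\<omega>. 1 / real s * hamming (\<eta> \<omega>) (support_vector \<theta>)) \<le>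
    (real CARD('d) - real (card (supp \<theta>))) / real s * b0 + real (card (supp \<theta>)) / real s * b1"
proof -
  let ?E = "\<lambda>j. {\<omega>\<in>space M. \<eta> \<omega> $ j \<noteq> support_vector \<theta> $ j}"
  have "expectation (\<lambda>\<omega>. 1 / real s * hamming (\<eta> \<omega>) (support_vector \<theta>)) =
      expectation (\<lambda>\<omega>. 1 / real s * (\<Sum>j\<in>UNIV. indicator (?E j) \<omega>))"
    unfolding hamming_def
    by (intro Bochner_Integration.integral_cong refl arg_cong2[where f = "(*)"] sum.cong) auto
  also have "\<dots> = 1 / real s * (\<Sum>j\<in>UNIV. prob (?E j))"
    by (subst Bochner_Integration.integral_mult_right_zero, subst Bochner_Integration.integral_sum)
      (auto simp: emeasure_eq_measure)
  also have "(\<Sum>j\<in>UNIV. prob (?E j)) = (\<Sum>j\<in>- supp \<theta>. prob (?E j)) + (\<Sum>j\<in>supp \<theta>. prob (?E j))"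
    by (subst sum.union_disjoint[symmetric]) (auto intro: arg_cong2[where f = sum])
  also have "1 / real s * \<dots> \<le> 1 / real s * (real (card (- supp \<theta>)) * b0 + real (card (supp \<theta>)) * b1)"
    using off on by (intro mult_left_mono add_mono sum_bounded_above) auto
  also have "real (card (- supp \<theta>)) = real CARD('d) - real (card (supp \<theta>))"
    by (simp add: Compl_eq_Diff_UNIV card_Diff_subset of_nat_diff card_mono)
  finally show ?thesis
    by (simp add: add_divide_distrib)
qed

section \<open>Risk of the two selectors\<close>

theorem proposition2p4:
  fixes M :: "'w measure" and D :: "real measure"
    and \<xi> W :: "nat \<Rightarrow> 'w \<Rightarrow> real ^ 'd"
    and \<sigma> c \<alpha> a C1 :: real and n s :: nat
  assumes "\<sigma> > 0" and "c > 0" and "\<alpha> > 0" and "n \<ge> 1"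
    and "1 \<le> s" and "s \<le> CARD('d)"
    and "noise_law c D"
    and "noise_model M n D \<xi> W"
    and "a \<ge> 2 * \<sigma>"
    and "C1 = 2 * cdf std_normal_distribution (2 * sqrt c) - 1"
  shows "C1 > 0 \<and>
    (\<forall>\<tau>>0. C1 - \<tau> > 0 \<longrightarrow> \<tau> * \<alpha> / (8 * real CARD('d)) \<le> 1 \<longrightarrow>
       \<alpha> * (C1 - \<tau>) / (8 * real CARD('d)) \<le> 1 \<longrightarrow>
       (\<forall>\<theta>\<in>sparse_class_pos s a.
          prob_space.expectation M (\<lambda>\<omega>. 1 / real s *
            hamming (selector_pos n \<tau> (privatize \<alpha> (observation \<sigma> \<theta> \<xi>) W) \<omega>) (support_vector \<theta>))
          \<le> (real CARD('d) - real (card (supp \<theta>))) / real s *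
               (exp (- (real n * \<tau>\<^sup>2 / 2 ^ 3))
                + exp (- (\<tau>\<^sup>2 * real n * \<alpha>\<^sup>2 / (2 ^ 7 * (real CARD('d))\<^sup>2))))
             + real (card (supp \<theta>)) / real s *
               (exp (- (real n * (C1 - \<tau>)\<^sup>2 / 2 ^ 3))
                + exp (- ((C1 - \<tau>)\<^sup>2 * real n * \<alpha>\<^sup>2 / (2 ^ 7 * (real CARD('d))\<^sup>2))))) \<and>
       (\<forall>\<theta>\<in>sparse_class s a.
          prob_space.expectation M (\<lambda>\<omega>. 1 / real s *
            hamming (selector n \<tau> (privatize \<alpha> (observation \<sigma> \<theta> \<xi>) W) \<omega>) (support_vector \<theta>))
          \<le> 2 * ((real CARD('d) - real (card (supp \<theta>))) / real s) *
               (exp (- (real n * \<tau>\<^sup>2 / 2 ^ 3))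
                + exp (- (\<tau>\<^sup>2 * real n * \<alpha>\<^sup>2 / (2 ^ 7 * (real CARD('d))\<^sup>2))))
             + 2 * (real (card (supp \<theta>)) / real s) *
               (exp (- (real n * (C1 - \<tau>)\<^sup>2 / 2 ^ 3))
                + exp (- ((C1 - \<tau>)\<^sup>2 * real n * \<alpha>\<^sup>2 / (2 ^ 7 * (real CARD('d))\<^sup>2))))))"
proof -
  from \<open>noise_model M n D \<xi> W\<close> interpret prob_space M
    by (simp add: noise_model_def)
  let ?I = "({1..n} \<times> (UNIV :: 'd set)) <+> ({1..n} \<times> (UNIV :: 'd set))"
  let ?N = "case_sum (\<lambda>(i, j) \<omega>. \<xi> i \<omega> $ j) (\<lambda>(i, j) \<omega>. W i \<omega> $ j)"
  have indep: "indep_vars (\<lambda>_. borel) ?N ?I"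
    and law_\<xi>: "\<And>i j. i \<in> {1..n} \<Longrightarrow> distr M borel (\<lambda>\<omega>. \<xi> i \<omega> $ j) = D"
    and law_W: "\<And>i j. i \<in> {1..n} \<Longrightarrow> distr M borel (\<lambda>\<omega>. W i \<omega> $ j) = laplace_distribution"
    using \<open>noise_model M n D \<xi> W\<close> unfolding noise_model_def by auto
  have indep_\<xi>: "indep_vars (\<lambda>_. borel) (\<lambda>i \<omega>. \<xi> i \<omega> $ j) {1..n}" for j
    using indep_vars_reindex[of "\<lambda>i. Inl (i, j)" "{1..n}" "\<lambda>_. borel" ?N]
      indep_vars_subset[OF indep, of "(\<lambda>i. Inl (i, j)) ` {1..n}"]
    by (auto simp: inj_on_def)
  have indep_W: "indep_vars (\<lambda>_. borel) (\<lambda>i \<omega>. W i \<omega> $ j) {1..n}" for j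
    using indep_vars_reindex[of "\<lambda>i. Inr (i, j)" "{1..n}" "\<lambda>_. borel" ?N]
      indep_vars_subset[OF indep, of "(\<lambda>i. Inr (i, j)) ` {1..n}"]
    by (auto simp: inj_on_def)
  have rv [measurable]: "random_variable borel (\<lambda>\<omega>. \<xi> i \<omega> $ j)" "random_variable borel (\<lambda>\<omega>. W i \<omega> $ j)"
    if "i \<in> {1..n}" for i j
    using indep_\<xi>[of j] indep_W[of j] that by (auto simp: indep_vars_def)
  have symm: "distr D borel uminus = D" and "prob_space D" and "sets D = sets borel"
    using \<open>noise_law c D\<close> by (auto simp: noise_law_def even_strongly_log_concave_def)
  then interpret D: finite_borel_measure D
    by (intro finite_borel_measure.intro finite_borel_measure_axioms.intro prob_space.finite_measure)

  \<comment> \<open>The bound at \<open>2\<close> extends to larger arguments by monotonicity. It is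
    applied to \<open>\<bar>\<theta> $ j\<bar> / \<sigma>\<close>, which is at least
    \<open>2\<close> on the support because \<open>a \<ge> 2 * \<sigma>\<close>.\<close>
  have C1_le: "C1 \<le> 2 * cdf D y - 1" if "2 \<le> y" for y
    using cdf_strongly_log_concave_ge[OF \<open>c > 0\<close> \<open>noise_law c D\<close>, of 2] D.cdf_nondecreasing[OF that]
      \<open>C1 = _\<close> by simp
  have "C1 > 0"
    using two_cdf_std_normal_eq[of "2 * sqrt c"] std_normal_measure_Icc_pos[of "2 * sqrt c"]
      \<open>c > 0\<close> \<open>C1 = _\<close> by simp

  \<comment> \<open>\<open>k\<close> is the scale of the Laplace noise. The admissible range
    \<open>t \<le> 4 * k\<close> of the tail bounds becomes the assumed bounds on
    \<open>\<tau>\<close> and \<open>C1 - \<tau>\<close>, and (t/k)^2 / 32 becomes the exponent with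
    \<open>2 ^ 7\<close>.\<close>
  define k where "k = 2 * real CARD('d) / \<alpha>"
  have k: "0 < k"
    using \<open>\<alpha> > 0\<close> by (simp add: k_def)
  define B where "B t = exp (- (real n * t\<^sup>2 / 2 ^ 3))
      + exp (- (t\<^sup>2 * real n * \<alpha>\<^sup>2 / (2 ^ 7 * (real CARD('d))\<^sup>2)))" for t
  have B_eq: "exp (- (real n * t\<^sup>2 / 8)) + exp (- (real n * (t / k)\<^sup>2 / 32)) = B t" for t
    using \<open>\<alpha> > 0\<close> by (simp add: B_def k_def power2_eq_square field_simps)
  have B_nonneg: "0 \<le> B t" for t
    by (simp add: B_def)
  define Z where "Z \<theta> = privatize \<alpha> (observation \<sigma> \<theta> \<xi>) W" for \<theta>
  define mean where "mean \<theta> j \<omega> = (\<Sum>i = 1..n. Z \<theta> i \<omega> $ j) / real n" for \<theta> j \<omega>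
  define V where "V \<theta> j i \<omega> = sgn1 (\<theta> $ j + \<sigma> * \<xi> i \<omega> $ j)" for \<theta> j i \<omega>
  have mean_eq: "mean \<theta> j \<omega> = (\<Sum>i = 1..n. V \<theta> j i \<omega> + k * W i \<omega> $ j) / real n" for \<theta> j \<omega>
    by (simp add: mean_def Z_def V_def privatize_def observation_def k_def)
  have mean_meas [measurable]: "random_variable borel (mean \<theta> j)" for \<theta> j
    unfolding mean_eq V_def by measurable
  have indep_V: "indep_vars (\<lambda>_. borel) (V \<theta> j) {1..n}" for \<theta> j
    unfolding V_def by (rule indep_vars_compose2[OF indep_\<xi>]) measurable
  have bounded_V: "V \<theta> j i \<omega> \<in> {-1..1}" for \<theta> j i \<omega>
    by (simp add: V_def sgn1_def)
  have mean_V: "expectation (V \<theta> j i) = 2 * cdf D (\<theta> $ j / \<sigma>) - 1" if "i \<in> {1..n}" for \<theta> j i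
    unfolding V_def using expectation_sgn1_shift[OF rv(1)[OF that] \<open>\<sigma> > 0\<close>] that
    by (simp add: law_\<xi> symm)
  have t_le: "t \<le> 4 * k" if "t * \<alpha> / (8 * real CARD('d)) \<le> 1" for t
    using that \<open>\<alpha> > 0\<close> by (simp add: k_def field_simps)
  have upper: "prob {\<omega>\<in>space M. m + t \<le> mean \<theta> j \<omega>} \<le> B t"
    if "0 < t" "t * \<alpha> / (8 * real CARD('d)) \<le> 1" "2 * cdf D (\<theta> $ j / \<sigma>) - 1 \<le> m" for \<theta> j m t
    unfolding mean_eq B_eq[symmetric] using that
    by (intro noisy_mean_upper_tail[OF \<open>n \<ge> 1\<close> indep_V indep_W bounded_V law_W _ k _ t_le])
      (auto simp: mean_V)
  have lower: "prob {\<omega>\<in>space M. mean \<theta> j \<omega> \<le> m - t} \<le> B t"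
    if "0 < t" "t * \<alpha> / (8 * real CARD('d)) \<le> 1" "m \<le> 2 * cdf D (\<theta> $ j / \<sigma>) - 1" for \<theta> j m t
    unfolding mean_eq B_eq[symmetric] using that
    by (intro noisy_mean_lower_tail[OF \<open>n \<ge> 1\<close> indep_V indep_W bounded_V law_W _ k _ t_le])
      (auto simp: mean_V)
  have cdf_0: "2 * cdf D 0 - 1 = 0"
    using cdf_noise_law_minus[OF \<open>noise_law c D\<close>, of 0] by simp

  have pos: "expectation (\<lambda>\<omega>. 1 / real s * hamming (selector_pos n \<tau> (Z \<theta>) \<omega>) (support_vector \<theta>))
      \<le> (real CARD('d) - real (card (supp \<theta>))) / real s * B \<tau>
        + real (card (supp \<theta>)) / real s * B (C1 - \<tau>)"
    if \<tau>: "0 < \<tau>" "C1 - \<tau> > 0" "\<tau> * \<alpha> / (8 * real CARD('d)) \<le> 1"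
      "\<alpha> * (C1 - \<tau>) / (8 * real CARD('d)) \<le> 1" and \<theta>: "\<theta> \<in> sparse_class_pos s a" for \<tau> \<theta>
  proof (rule expectation_hamming_le)
    have comp: "selector_pos n \<tau> (Z \<theta>) \<omega> $ j = of_bool (\<tau> \<le> mean \<theta> j \<omega>)" for j \<omega>
      by (simp add: selector_pos_def mean_def)
    fix j
    show "{\<omega>\<in>space M. selector_pos n \<tau> (Z \<theta>) \<omega> $ j \<noteq> support_vector \<theta> $ j} \<in> events"
      unfolding comp by measurable
    show "prob {\<omega>\<in>space M. selector_pos n \<tau> (Z \<theta>) \<omega> $ j \<noteq> support_vector \<theta> $ j} \<le> B \<tau>"
      if "j \<notin> supp \<theta>"
      using upper[OF \<tau>(1,3), of \<theta> j 0] that cdf_0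
      by (simp add: comp support_vector_def supp_def)
    show "prob {\<omega>\<in>space M. selector_pos n \<tau> (Z \<theta>) \<omega> $ j \<noteq> support_vector \<theta> $ j} \<le> B (C1 - \<tau>)"
      if "j \<in> supp \<theta>"
    proof -
      have "a \<le> \<theta> $ j"
        using \<theta> that by (auto simp: sparse_class_pos_def supp_def)
      then have "C1 \<le> 2 * cdf D (\<theta> $ j / \<sigma>) - 1"
        using \<open>a \<ge> 2 * \<sigma>\<close> \<open>\<sigma> > 0\<close> by (intro C1_le) (simp add: field_simps)
      \<comment> \<open>A miss puts the mean below \<open>\<tau>\<close>, which is a deviation by
        \<open>C1 - \<tau>\<close> below the lower bound \<open>C1\<close> of the expected
        sign.\<close>
      then have "prob {\<omega>\<in>space M. mean \<theta> j \<omega> \<le> C1 - (C1 - \<tau>)} \<le> B (C1 - \<tau>)"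
        using \<tau> by (intro lower) (auto simp: mult.commute)
      moreover have "prob {\<omega>\<in>space M. selector_pos n \<tau> (Z \<theta>) \<omega> $ j \<noteq> support_vector \<theta> $ j}
          \<le> prob {\<omega>\<in>space M. mean \<theta> j \<omega> \<le> C1 - (C1 - \<tau>)}"
        using that by (intro finite_measure_mono) (auto simp: comp support_vector_def supp_def)
      ultimately show ?thesis by simp
    qed
  qed

  have two_sided: "expectation (\<lambda>\<omega>. 1 / real s * hamming (selector n \<tau> (Z \<theta>) \<omega>) (support_vector \<theta>))
      \<le> (real CARD('d) - real (card (supp \<theta>))) / real s * (2 * B \<tau>)
        + real (card (supp \<theta>)) / real s * (2 * B (C1 - \<tau>))"
    if \<tau>: "0 < \<tau>" "C1 - \<tau> > 0" "\<tau> * \<alpha> / (8 * real CARD('d)) \<le> 1"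
      "\<alpha> * (C1 - \<tau>) / (8 * real CARD('d)) \<le> 1" and \<theta>: "\<theta> \<in> sparse_class s a" for \<tau> \<theta>
  proof (rule expectation_hamming_le)
    have comp: "selector n \<tau> (Z \<theta>) \<omega> $ j = of_bool (\<tau> \<le> \<bar>mean \<theta> j \<omega>\<bar>)" for j \<omega>
      by (simp add: selector_def mean_def)
    fix j
    let ?E = "{\<omega>\<in>space M. selector n \<tau> (Z \<theta>) \<omega> $ j \<noteq> support_vector \<theta> $ j}"
    show "?E \<in> events"
      unfolding comp by measurable
    show "prob ?E \<le> 2 * B \<tau>" if "j \<notin> supp \<theta>"
    proof -
      \<comment> \<open>The expected sign is \<open>0\<close>, so a false selection is a deviation
        by \<open>\<tau>\<close> in either direction; the union bound gives the factor
        \<open>2\<close>.\<close>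
      have "prob ?E \<le> prob ({\<omega>\<in>space M. 0 + \<tau> \<le> mean \<theta> j \<omega>} \<union> {\<omega>\<in>space M. mean \<theta> j \<omega> \<le> 0 - \<tau>})"
        using that by (intro finite_measure_mono) (auto simp: comp support_vector_def supp_def)
      also have "\<dots> \<le> prob {\<omega>\<in>space M. 0 + \<tau> \<le> mean \<theta> j \<omega>} + prob {\<omega>\<in>space M. mean \<theta> j \<omega> \<le> 0 - \<tau>}"
        by (intro measure_Un_le) auto
      also have "\<dots> \<le> B \<tau> + B \<tau>"
        using that cdf_0 by (intro add_mono upper lower \<tau>) (auto simp: supp_def)
      finally show ?thesis by simp
    qed
    show "prob ?E \<le> 2 * B (C1 - \<tau>)" if j: "j \<in> supp \<theta>"
    proof -
      have "a \<le> \<bar>\<theta> $ j\<bar>"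
        using \<theta> j by (auto simp: sparse_class_def supp_def)
      then consider "2 \<le> \<theta> $ j / \<sigma>" | "2 \<le> - (\<theta> $ j / \<sigma>)"
        using \<open>a \<ge> 2 * \<sigma>\<close> \<open>\<sigma> > 0\<close> by (cases "0 \<le> \<theta> $ j") (auto simp: field_simps)
      \<comment> \<open>Once the sign of \<open>\<theta> $ j\<close> is known, a miss forces a
        deviation in one direction only, so a single \<open>B\<close> suffices; the factor
        \<open>2\<close> enters afterwards by nonnegativity.\<close>
      then have "prob ?E \<le> B (C1 - \<tau>)"
      proof cases
        case 1
        have "prob ?E \<le> prob {\<omega>\<in>space M. mean \<theta> j \<omega> \<le> C1 - (C1 - \<tau>)}"
          using j by (intro finite_measure_mono) (auto simp: comp support_vector_def supp_def)
        also have "\<dots> \<le> B (C1 - \<tau>)"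
          using \<tau> by (intro lower C1_le 1) (auto simp: mult.commute)
        finally show ?thesis .
      next
        case 2
        \<comment> \<open>For a negative coordinate the symmetry of \<open>cdf D\<close> bounds the
          expected sign by \<open>- C1\<close>, and a miss gives a mean above
          \<open>- \<tau>\<close>, which equals \<open>- C1 + (C1 - \<tau>)\<close>.\<close>
        have "prob ?E \<le> prob {\<omega>\<in>space M. - C1 + (C1 - \<tau>) \<le> mean \<theta> j \<omega>}"
          using j by (intro finite_measure_mono) (auto simp: comp support_vector_def supp_def)
        also have "\<dots> \<le> B (C1 - \<tau>)"
          using \<tau> C1_le[OF 2] cdf_noise_law_minus[OF \<open>noise_law c D\<close>, of "\<theta> $ j / \<sigma>"]
          by (intro upper) (auto simp: mult.commute)
        finally show ?thesis .
      qed
      then show ?thesis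
        using B_nonneg[of "C1 - \<tau>"] by simp
    qed
  qed

  show ?thesis
    unfolding B_def[symmetric] Z_def[symmetric]
  proof (intro conjI allI impI ballI)
    fix \<tau> and \<theta> :: "real ^ 'd"
    assume \<tau>: "0 < \<tau>" "C1 - \<tau> > 0" "\<tau> * \<alpha> / (8 * real CARD('d)) \<le> 1"
      "\<alpha> * (C1 - \<tau>) / (8 * real CARD('d)) \<le> 1" and "\<theta> \<in> sparse_class s a"
    from two_sided[OF this] show
      "expectation (\<lambda>\<omega>. 1 / real s * hamming (selector n \<tau> (Z \<theta>) \<omega>) (support_vector \<theta>))
        \<le> 2 * ((real CARD('d) - real (card (supp \<theta>))) / real s) * B \<tau>
          + 2 * (real (card (supp \<theta>)) / real s) * B (C1 - \<tau>)"
      by (simp only: mult.assoc mult.left_commute[of 2])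
  qed (rule \<open>C1 > 0\<close>, rule pos)
qed

end
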